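(* Let $\theta>0$, $\beta\in\mathbb{R}$, let $G$ be drawn from the two-star model $\mathbb{P}_n$ with parameters $(\theta,\beta)$, let $Y_{ij}=2G_{ij}-1$ for $i\neq j$, $Y_{ii}=0$, and let $k_i(Y)=\sum_{j=1}^nY_{ij}$. Let $W_1,\dots,W_n$ be i.i.d. $N(0,1)$ independent of $Y$, and let $\phi=(\phi_1,\dots,\phi_n)$ with $$\phi_i=\frac{k_i(Y)}{n-1}+\frac{W_i}{\sqrt{(n-1)\theta}}.$$ (a) Given $\phi$, the random variables $\{Y_{ij}\}_{1\le i<j\le n}$ are mutually independent, with $$\mathbb{P}_n(Y_{ij}=1\mid\phi)=\frac{e^{\theta(\phi_i+\phi_j)+\beta}}{e^{\theta(\phi_i+\phi_j)+\beta}+e^{-\theta(\phi_i+\phi_j)-\beta}}.$$ (b) The random vector $\phi$ has a density on $\mathbb{R}^n$ (with respect to Lebesgue measure) proportional to $e^{-f_n(\phi)}$, where $f_n(\phi):=\sum_{i<j}p(\phi_i,\phi_j)$ with $$p(x,y)=\frac{\theta}{2}(x^2+y^2)-\log\cosh[\theta(x+y)+\beta]=\frac{\theta}{4}(x-y)^2+q\Big(\frac{x+y}{2}\Big),$$ and $q(x)=\theta x^2-\log\cosh(2\theta x+\beta)$.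
   Context: Let $\mathcal{G}_n$ be the set of simple labeled graphs on $[n]=\{1,\dots,n\}$ ($n\ge 2$), identified with their symmetric $0/1$ adjacency matrices $G=(G_{ij})$ with $G_{ii}=0$. Let $d_i(G)=\sum_j G_{ij}$, $E(G)=\sum_{i<j}G_{ij}$, $T(G)=\sum_{i=1}^n\binom{d_i(G)}{2}$. Given $\omega_1>0,\omega_2\in\mathbb{R}$, the two-star model is the probability mass function on $\mathcal{G}_n$ $$\mathbb{P}_n(G=g)=\frac{1}{Z_n(\omega_1,\omega_2)}\exp\Big\{\Big(\omega_2+\frac{\omega_1}{n-1}\Big)E(g)+\frac{\omega_1}{n-1}T(g)\Big\},$$ with $Z_n$ the normalizing constant. The parameters are rewritten as $\theta:=\omega_1/4>0$, $\beta:=(\omega_1+\omega_2)/2\in\mathbb{R}$. The notation $\mathbb{P}_n$ is also used for the joint law of $(Y,\phi)$. *)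

theory Defs
  imports "HOL-Probability.Probability"
begin

text \<open>
  Graphs on \<open>{1..n}\<close> are symmetric 0/1 adjacency matrices. A matrix is a function on all of
  \<open>nat \<times> nat\<close>, extended by zero outside \<open>{1..n} \<times> {1..n}\<close>, so that each graph has exactly one
  representative.
\<close>

definition graphs :: "nat \<Rightarrow> (nat \<Rightarrow> nat \<Rightarrow> nat) set" where
  "graphs n = {g. (\<forall>i j. g i j \<in> {0, 1}) \<and> (\<forall>i j. g i j = g j i) \<and> (\<forall>i. g i i = 0) \<and>
     (\<forall>i j. g i j \<noteq> 0 \<longrightarrow> i \<in> {1..n} \<and> j \<in> {1..n})}"

definition pairs :: "nat \<Rightarrow> (nat \<times> nat) set" where
  "pairs n = {(i, j). 1 \<le> i \<and> i < j \<and> j \<le> n}"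

definition deg :: "nat \<Rightarrow> (nat \<Rightarrow> nat \<Rightarrow> nat) \<Rightarrow> nat \<Rightarrow> nat" where
  "deg n g i = (\<Sum>j=1..n. g i j)"

definition num_edges :: "nat \<Rightarrow> (nat \<Rightarrow> nat \<Rightarrow> nat) \<Rightarrow> nat" where
  "num_edges n g = (\<Sum>(i, j)\<in>pairs n. g i j)"

definition num_two_stars :: "nat \<Rightarrow> (nat \<Rightarrow> nat \<Rightarrow> nat) \<Rightarrow> nat" where
  "num_two_stars n g = (\<Sum>i=1..n. deg n g i choose 2)"

definition two_star_weight :: "nat \<Rightarrow> real \<Rightarrow> real \<Rightarrow> (nat \<Rightarrow> nat \<Rightarrow> nat) \<Rightarrow> real" where
  "two_star_weight n \<omega>1 \<omega>2 g =
     exp ((\<omega>2 + \<omega>1 / (real n - 1)) * real (num_edges n g)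
          + \<omega>1 / (real n - 1) * real (num_two_stars n g))"

definition two_star_Z :: "nat \<Rightarrow> real \<Rightarrow> real \<Rightarrow> real" where
  "two_star_Z n \<omega>1 \<omega>2 = (\<Sum>g\<in>graphs n. two_star_weight n \<omega>1 \<omega>2 g)"

definition two_star_prob :: "nat \<Rightarrow> real \<Rightarrow> real \<Rightarrow> (nat \<Rightarrow> nat \<Rightarrow> nat) \<Rightarrow> real" where
  "two_star_prob n \<omega>1 \<omega>2 g = two_star_weight n \<omega>1 \<omega>2 g / two_star_Z n \<omega>1 \<omega>2"

text \<open>
  Outside \<open>{1..n} \<times> {1..n}\<close> the off-diagonal entries of \<open>spin g\<close> are the constant \<open>-1\<close> and are never used.
\<close>

definition spin :: "(nat \<Rightarrow> nat \<Rightarrow> nat) \<Rightarrow> nat \<Rightarrow> nat \<Rightarrow> real" where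
  "spin g i j = (if i = j then 0 else 2 * real (g i j) - 1)"

definition row_sum :: "nat \<Rightarrow> (nat \<Rightarrow> nat \<Rightarrow> real) \<Rightarrow> nat \<Rightarrow> real" where
  "row_sum n y i = (\<Sum>j=1..n. y i j)"

text \<open>
  Only the space and the measurable sets of \<open>gen_sigma M X N\<close> matter; its measure is zero and plays
  no role.
\<close>

definition gen_sigma :: "'a measure \<Rightarrow> ('a \<Rightarrow> 'b) \<Rightarrow> 'b measure \<Rightarrow> 'a measure" where
  "gen_sigma M X N = vimage_algebra (space M) X N"

text \<open>
  Conditional probability of an event given a sub-sigma-algebra; as for any conditional
  expectation, only its almost sure class is meaningful.
\<close>

definition cprob :: "'a measure \<Rightarrow> 'a measure \<Rightarrow> 'a set \<Rightarrow> 'a \<Rightarrow> real" where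
  "cprob M F A = real_cond_exp M F (indicator A)"

text \<open>
  The requirement \<open>subalgebra M F\<close> is needed because \<^const>\<open>real_cond_exp\<close> is constantly zero
  otherwise.
\<close>

definition cond_indep_vars ::
  "'a measure \<Rightarrow> 'a measure \<Rightarrow> ('i \<Rightarrow> 'b measure) \<Rightarrow> ('i \<Rightarrow> 'a \<Rightarrow> 'b) \<Rightarrow> 'i set \<Rightarrow> bool" where
  "cond_indep_vars M F N X I \<longleftrightarrow>
     subalgebra M F \<and> (\<forall>i\<in>I. X i \<in> measurable M (N i)) \<and>
     (\<forall>J A. J \<subseteq> I \<longrightarrow> J \<noteq> {} \<longrightarrow> finite J \<longrightarrow> (\<forall>j\<in>J. A j \<in> sets (N j)) \<longrightarrow>
        (AE \<omega> in M. cprob M F (\<Inter>j\<in>J. X j -` A j \<inter> space M) \<omega>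
                  = (\<Prod>j\<in>J. cprob M F (X j -` A j \<inter> space M) \<omega>)))"

definition p_fun :: "real \<Rightarrow> real \<Rightarrow> real \<Rightarrow> real \<Rightarrow> real" where
  "p_fun \<theta> \<beta> x y = \<theta> / 2 * (x\<^sup>2 + y\<^sup>2) - ln (cosh (\<theta> * (x + y) + \<beta>))"

definition q_fun :: "real \<Rightarrow> real \<Rightarrow> real \<Rightarrow> real" where
  "q_fun \<theta> \<beta> x = \<theta> * x\<^sup>2 - ln (cosh (2 * \<theta> * x + \<beta>))"

definition f_fun :: "nat \<Rightarrow> real \<Rightarrow> real \<Rightarrow> (nat \<Rightarrow> real) \<Rightarrow> real" where
  "f_fun n \<theta> \<beta> x = (\<Sum>(i, j)\<in>pairs n. p_fun \<theta> \<beta> (x i) (x j))"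

end

theory Submission
  imports Defs
begin

text \<open>
  Completing squares, the weight of a graph \<open>g\<close> with spins \<open>y = spin g\<close> and row sums \<open>k\<^sub>i\<close> is a
  constant times \<open>exp (\<Sum>\<^sub>i \<beta>/2 k\<^sub>i + \<theta>/(2(n-1)) k\<^sub>i\<^sup>2)\<close>. Given \<open>g\<close>, the coordinates of \<open>\<phi>\<close> are
  independent normals with means \<open>k\<^sub>i/(n-1)\<close> and variance \<open>1/((n-1)\<theta>)\<close>, and the term \<open>k\<^sub>i\<^sup>2\<close> of their
  joint density cancels the one in the weight (Hubbard-Stratonovich). So the joint density of \<open>(g, \<phi>)\<close>
  is a function of \<open>\<phi>\<close> times \<open>\<Prod>\<^sub>i\<^sub><\<^sub>j exp (y\<^sub>i\<^sub>j (\<theta>(\<phi>\<^sub>i + \<phi>\<^sub>j) + \<beta>))\<close>, which factorizes over the edges.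
  Bayes' formula gives (a), and summing over \<open>g\<close> turns the product into \<open>\<Prod>\<^sub>i\<^sub><\<^sub>j 2 cosh (\<theta>(\<phi>\<^sub>i + \<phi>\<^sub>j) + \<beta>)\<close>,
  which gives (b).
\<close>

section \<open>Sums over edges and sums over graphs\<close>

lemma finite_pairs [simp]: "finite (pairs n)"
  by (rule finite_subset[of _ "{1..n} \<times> {1..n}"]) (auto simp: pairs_def)

text \<open>The square is the disjoint union of its diagonal, \<open>pairs n\<close> and the mirror
  image of \<open>pairs n\<close>. This converts vertex sums into edge sums, for degrees in
  \<open>nat\<close> as well as for spins in \<open>real\<close>.\<close>

lemma sum_square_pairs:
  fixes F :: "nat \<Rightarrow> nat \<Rightarrow> 'a :: comm_monoid_add"
  shows "(\<Sum>i=1..n. \<Sum>j=1..n. F i j) = (\<Sum>i=1..n. F i i) + (\<Sum>(i, j)\<in>pairs n. F i j + F j i)"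
proof -
  let ?D = "(\<lambda>i. (i, i)) ` {1..n}" and ?P = "prod.swap ` pairs n"
  have "{1..n} \<times> {1..n} = ?D \<union> (pairs n \<union> ?P)"
    by (auto simp: pairs_def image_iff)
  then have "(\<Sum>i=1..n. \<Sum>j=1..n. F i j) = (\<Sum>(i, j)\<in>?D \<union> (pairs n \<union> ?P). F i j)"
    by (simp add: sum.cartesian_product)
  also have "\<dots> = (\<Sum>(i, j)\<in>?D. F i j) + (\<Sum>(i, j)\<in>pairs n \<union> ?P. F i j)"
    by (rule sum.union_disjoint) (simp_all, auto simp: pairs_def)
  also have "(\<Sum>(i, j)\<in>pairs n \<union> ?P. F i j) = (\<Sum>(i, j)\<in>pairs n. F i j) + (\<Sum>(i, j)\<in>?P. F i j)"
    by (rule sum.union_disjoint) (simp_all, auto simp: pairs_def)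
  also have "(\<Sum>(i, j)\<in>?P. F i j) = (\<Sum>(i, j)\<in>pairs n. F j i)"
    by (subst sum.reindex) (auto simp: split_def)
  also have "(\<Sum>(i, j)\<in>?D. F i j) = (\<Sum>i=1..n. F i i)"
    by (subst sum.reindex) (auto simp: inj_on_def)
  finally show ?thesis by (simp add: sum.distrib split_def)
qed

text \<open>Symmetrizes free edge labels. The default 0 on the diagonal and outside the vertex set
  matches the convention of \<open>graphs\<close>, so restriction to \<open>pairs n\<close> is the
  inverse.\<close>

definition graph_of_edges :: "nat \<Rightarrow> (nat \<times> nat \<Rightarrow> nat) \<Rightarrow> nat \<Rightarrow> nat \<Rightarrow> nat" where
  "graph_of_edges n h i j =
     (if (i, j) \<in> pairs n then h (i, j) else if (j, i) \<in> pairs n then h (j, i) else 0)"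

text \<open>A graph is a free choice of 0 or 1 on each edge. Sums over graphs move to this function
  space, where they arise from expanding products of sums.\<close>

lemma bij_betw_graph_of_edges: "bij_betw (graph_of_edges n) (pairs n \<rightarrow>\<^sub>E {0, 1}) (graphs n)"
proof (rule bij_betw_byWitness[where f' = "\<lambda>g. restrict (\<lambda>(i, j). g i j) (pairs n)"])
  show "\<forall>h\<in>pairs n \<rightarrow>\<^sub>E {0, 1}. (\<lambda>(i, j)\<in>pairs n. graph_of_edges n h i j) = h"
    by (auto simp: graph_of_edges_def fun_eq_iff PiE_def extensional_def)
  show "\<forall>g\<in>graphs n. graph_of_edges n (\<lambda>(i, j)\<in>pairs n. g i j) = g"
  proof (intro ballI ext)
    fix g i j assume g: "g \<in> graphs n"
    consider "(i, j) \<in> pairs n" | "(j, i) \<in> pairs n" "(i, j) \<notin> pairs n" | "i = j"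
      | "i \<notin> {1..n} \<or> j \<notin> {1..n}" "(i, j) \<notin> pairs n" "(j, i) \<notin> pairs n"
      using linorder_less_linear[of i j] by (auto simp: pairs_def)
    then show "graph_of_edges n (\<lambda>(i, j)\<in>pairs n. g i j) i j = g i j"
      using g by cases (auto simp: graph_of_edges_def graphs_def pairs_def)
  qed
  show "graph_of_edges n ` (pairs n \<rightarrow>\<^sub>E {0, 1}) \<subseteq> graphs n"
  proof (rule image_subsetI)
    fix h :: "nat \<times> nat \<Rightarrow> nat" assume h: "h \<in> pairs n \<rightarrow>\<^sub>E {0, 1}"
    have "h p \<in> {0, 1}" if "p \<in> pairs n" for p
      using h that by (rule PiE_mem)
    moreover have "(i, j) \<in> pairs n \<Longrightarrow> (j, i) \<notin> pairs n" for i j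
      by (auto simp: pairs_def)
    ultimately show "graph_of_edges n h \<in> graphs n"
      unfolding graphs_def graph_of_edges_def by (auto simp: pairs_def)
  qed
  show "(\<lambda>g. \<lambda>(i, j)\<in>pairs n. g i j) ` graphs n \<subseteq> pairs n \<rightarrow>\<^sub>E {0, 1}"
  proof (rule image_subsetI)
    fix g assume "g \<in> graphs n"
    then have "g i j \<in> {0, 1}" for i j
      unfolding graphs_def by blast
    then show "(\<lambda>(i, j)\<in>pairs n. g i j) \<in> pairs n \<rightarrow>\<^sub>E {0, 1}"
      by (intro restrict_PiE_iff[THEN iffD2] ballI) (simp only: split_paired_all prod.case)
  qed
qed

lemma finite_graphs [simp]: "finite (graphs n)"
  using bij_betw_finite[OF bij_betw_graph_of_edges] finite_PiE[OF finite_pairs, of n "\<lambda>_. {0, 1}"] by blast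

text \<open>Distributive law: expanding the product on the right chooses the spin 1 or -1 for every
  edge, and each choice is one graph.\<close>

lemma sum_graphs_prod_pairs:
  fixes f :: "nat \<times> nat \<Rightarrow> real \<Rightarrow> real"
  shows "(\<Sum>g\<in>graphs n. \<Prod>p\<in>pairs n. f p (case p of (i, j) \<Rightarrow> spin g i j)) = (\<Prod>p\<in>pairs n. f p 1 + f p (-1))"
proof -
  have "(\<Sum>g\<in>graphs n. \<Prod>p\<in>pairs n. f p (case p of (i, j) \<Rightarrow> spin g i j))
    = (\<Sum>h\<in>pairs n \<rightarrow>\<^sub>E {0, 1}. \<Prod>p\<in>pairs n. f p (case p of (i, j) \<Rightarrow> spin (graph_of_edges n h) i j))"
    by (rule sum.reindex_bij_betw[OF bij_betw_graph_of_edges, symmetric])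
  also have "\<dots> = (\<Sum>h\<in>pairs n \<rightarrow>\<^sub>E {0, 1}. \<Prod>p\<in>pairs n. f p (2 * real (h p) - 1))"
    by (intro sum.cong prod.cong refl) (auto simp: spin_def graph_of_edges_def pairs_def)
  also have "\<dots> = (\<Prod>p\<in>pairs n. f p 1 + f p (-1))"
    by (subst prod_sum_PiE[symmetric]) (auto simp: add.commute)
  finally show ?thesis .
qed

section \<open>Spins, degrees and the two-star weight\<close>

lemma spin_sym: "g \<in> graphs n \<Longrightarrow> spin g i j = spin g j i"
  by (auto simp: spin_def graphs_def)

lemma row_sum_spin:
  assumes "i \<in> {1..n}" "g \<in> graphs n"
  shows "row_sum n (spin g) i = 2 * real (deg n g i) - (real n - 1)"
proof -
  \<comment> \<open>The diagonal spin is 0, whereas \<open>2 * g i i - 1\<close> is -1; this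
    correction makes the shift \<open>n - 1\<close> instead of \<open>n\<close>.\<close>
  have "spin g i j = 2 * real (g i j) - 1 + (if i = j then 1 else 0)" for j
    using assms by (auto simp: spin_def graphs_def)
  then show ?thesis
    using assms(1) by (simp add: row_sum_def deg_def sum.distrib sum_subtractf sum_distrib_left)
qed

lemma sum_row_sum_spin:
  assumes "g \<in> graphs n"
  shows "(\<Sum>i=1..n. x i * row_sum n (spin g) i) = (\<Sum>(i, j)\<in>pairs n. (x i + x j) * spin g i j)"
proof -
  have "(\<Sum>i=1..n. x i * row_sum n (spin g) i) = (\<Sum>i=1..n. \<Sum>j=1..n. x i * spin g i j)"
    by (simp add: row_sum_def sum_distrib_left)
  also have "\<dots> = (\<Sum>(i, j)\<in>pairs n. x i * spin g i j + x j * spin g j i)"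
    by (subst sum_square_pairs) (simp add: spin_def)
  also have "\<dots> = (\<Sum>(i, j)\<in>pairs n. (x i + x j) * spin g i j)"
    using spin_sym[OF assms] by (intro sum.cong refl) (auto simp: distrib_right)
  finally show ?thesis .
qed

text \<open>Each vertex lies in exactly \<open>n - 1\<close> pairs.\<close>

lemma sum_pairs_add:
  fixes x :: "nat \<Rightarrow> real"
  shows "(\<Sum>(i, j)\<in>pairs n. x i + x j) = (real n - 1) * (\<Sum>i=1..n. x i)"
  using sum_square_pairs[of "\<lambda>i j. x i" n] by (simp add: algebra_simps flip: sum_distrib_left)

text \<open>Handshake lemma: each edge is counted at both of its ends.\<close>

lemma sum_deg:
  assumes "g \<in> graphs n"
  shows "(\<Sum>i=1..n. deg n g i) = 2 * num_edges n g"
proof -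
  have "(\<Sum>i=1..n. deg n g i) = (\<Sum>(i, j)\<in>pairs n. g i j + g j i)"
    unfolding deg_def using assms by (subst sum_square_pairs) (simp add: graphs_def)
  also have "\<dots> = (\<Sum>(i, j)\<in>pairs n. 2 * g i j)"
    using assms by (intro sum.cong refl) (auto simp: graphs_def mult_2)
  finally show ?thesis
    by (simp add: num_edges_def sum_distrib_left split_def)
qed

lemma real_choose_two: "real (d choose 2) = real d * (real d - 1) / 2"
  by (cases d) (simp_all add: choose_two real_of_nat_div algebra_simps)

text \<open>As the edge count is half the degree sum, the exponent splits over the vertices. The
  extra \<open>\<omega>1 / (n - 1)\<close> on the edge count cancels the linear part of
  \<open>d * (d - 1) / 2\<close>, and \<open>d = (k + n - 1) / 2\<close> turns the rest into a
  quadratic in the row sum \<open>k\<close>.\<close>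

lemma two_star_weight_row_sum:
  assumes "n \<ge> 2" "g \<in> graphs n"
  shows "two_star_weight n \<omega>1 \<omega>2 g =
    exp (\<Sum>i=1..n. (real n - 1) * (\<omega>2 / 4 + \<omega>1 / 8) + (\<omega>1 + \<omega>2) / 4 * row_sum n (spin g) i
           + \<omega>1 / (8 * (real n - 1)) * (row_sum n (spin g) i)\<^sup>2)"
proof -
  define m where "m = real n - 1"
  have m: "m > 0" using assms(1) by (simp add: m_def)
  have E: "real (num_edges n g) = (\<Sum>i=1..n. real (deg n g i) / 2)"
    using sum_deg[OF assms(2)] by (simp flip: sum_divide_distrib of_nat_sum)
  have "(\<omega>2 + \<omega>1 / m) * real (num_edges n g) + \<omega>1 / m * real (num_two_stars n g)
     = (\<Sum>i=1..n. (\<omega>2 + \<omega>1 / m) * (real (deg n g i) / 2)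
          + \<omega>1 / m * (real (deg n g i) * (real (deg n g i) - 1) / 2))"
    unfolding E num_two_stars_def by (simp add: sum.distrib sum_distrib_left real_choose_two)
  also have "\<dots> = (\<Sum>i=1..n. m * (\<omega>2 / 4 + \<omega>1 / 8) + (\<omega>1 + \<omega>2) / 4 * row_sum n (spin g) i
           + \<omega>1 / (8 * m) * (row_sum n (spin g) i)\<^sup>2)"
  proof (rule sum.cong[OF refl])
    fix i assume "i \<in> {1..n}"
    then have "real (deg n g i) = (row_sum n (spin g) i + m) / 2"
      using row_sum_spin assms(2) by (simp add: m_def)
    then show "(\<omega>2 + \<omega>1 / m) * (real (deg n g i) / 2) + \<omega>1 / m * (real (deg n g i) * (real (deg n g i) - 1) / 2)
      = m * (\<omega>2 / 4 + \<omega>1 / 8) + (\<omega>1 + \<omega>2) / 4 * row_sum n (spin g) i + \<omega>1 / (8 * m) * (row_sum n (spin g) i)\<^sup>2"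
      using m by (simp only:) (simp add: field_simps power2_eq_square)
  qed
  finally show ?thesis
    by (simp add: two_star_weight_def m_def)
qed

lemma two_star_Z_pos: "two_star_Z n \<omega>1 \<omega>2 > 0"
proof -
  have "(\<lambda>_ _. 0) \<in> graphs n" by (simp add: graphs_def)
  then show ?thesis
    unfolding two_star_Z_def
    by (intro sum_pos) (auto simp: finite_graphs two_star_weight_def)
qed

lemma two_star_prob_nonneg: "0 \<le> two_star_prob n \<omega>1 \<omega>2 g"
  using two_star_Z_pos[of n \<omega>1 \<omega>2] by (simp add: two_star_prob_def two_star_weight_def)

section \<open>The joint density of graph and Gaussian vector\<close>

text \<open>The constant \<open>c\<close> depends on neither \<open>g\<close> nor \<open>x\<close>,
  and \<open>g\<close> enters through the last product alone, so the other factors cancel in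
  conditional probabilities given \<open>x\<close>.\<close>

lemma two_star_joint_density:
  assumes "n \<ge> 2" "\<theta> > 0" "\<theta> = \<omega>1 / 4" "\<beta> = (\<omega>1 + \<omega>2) / 2"
  shows "\<exists>c>0. \<forall>g\<in>graphs n. \<forall>x.
    two_star_prob n \<omega>1 \<omega>2 g * (\<Prod>i=1..n. normal_density (row_sum n (spin g) i / (real n - 1)) (1 / sqrt ((real n - 1) * \<theta>)) (x i))
    = c * exp (- (\<Sum>(i, j)\<in>pairs n. \<theta> / 2 * ((x i)\<^sup>2 + (x j)\<^sup>2)))
        * (\<Prod>(i, j)\<in>pairs n. exp (spin g i j * (\<theta> * (x i + x j) + \<beta>)))"
proof -
  define m where "m = real n - 1"
  define \<sigma> where "\<sigma> = 1 / sqrt (m * \<theta>)"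
  \<comment> \<open>\<open>D\<close> gathers the constant part of the weight, the partition function
    and the \<open>n\<close> normalizing factors of the normal densities.\<close>
  define D where "D = exp (\<Sum>i=1..n. m * (\<omega>2 / 4 + \<omega>1 / 8)) / two_star_Z n \<omega>1 \<omega>2 * (1 / sqrt (2 * pi * \<sigma>\<^sup>2)) ^ n"
  have m: "m > 0" using assms(1) by (simp add: m_def)
  have s: "\<sigma> > 0" "\<sigma>\<^sup>2 = 1 / (m * \<theta>)"
    using m assms(2) by (simp_all add: \<sigma>_def power_divide)
  have "D > 0"
    using two_star_Z_pos s(1) by (simp add: D_def)
  moreover have "two_star_prob n \<omega>1 \<omega>2 g * (\<Prod>i=1..n. normal_density (row_sum n (spin g) i / m) \<sigma> (x i))
    = D * exp (- (\<Sum>(i, j)\<in>pairs n. \<theta> / 2 * ((x i)\<^sup>2 + (x j)\<^sup>2)))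
        * (\<Prod>(i, j)\<in>pairs n. exp (spin g i j * (\<theta> * (x i + x j) + \<beta>)))"
    if g: "g \<in> graphs n" for g x
  proof -
    let ?k = "row_sum n (spin g)"
    have "(\<Sum>i=1..n. m * (\<omega>2 / 4 + \<omega>1 / 8) + (\<omega>1 + \<omega>2) / 4 * ?k i + \<omega>1 / (8 * m) * (?k i)\<^sup>2)
        + (\<Sum>i=1..n. - (x i - ?k i / m)\<^sup>2 / (2 * \<sigma>\<^sup>2))
      = (\<Sum>i=1..n. m * (\<omega>2 / 4 + \<omega>1 / 8) - m * (\<theta> / 2 * (x i)\<^sup>2) + (\<theta> * x i + \<beta> / 2) * ?k i)"
      unfolding sum.distrib[symmetric]
    proof (rule sum.cong[OF refl])
      fix i
      have w: "\<omega>1 = 4 * \<theta>" "\<omega>2 = 2 * \<beta> - 4 * \<theta>"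
        using assms by auto
      \<comment> \<open>Since \<open>1 / \<sigma>\<^sup>2 = m * \<theta>\<close>, the square yields
        the cross term \<open>\<theta> * x i * k\<close> and a term
        \<open>- \<theta> * k\<^sup>2 / (2 * m)\<close>, which cancels the quadratic term of the
        weight.\<close>
      show "m * (\<omega>2 / 4 + \<omega>1 / 8) + (\<omega>1 + \<omega>2) / 4 * ?k i + \<omega>1 / (8 * m) * (?k i)\<^sup>2 + - (x i - ?k i / m)\<^sup>2 / (2 * \<sigma>\<^sup>2)
        = m * (\<omega>2 / 4 + \<omega>1 / 8) - m * (\<theta> / 2 * (x i)\<^sup>2) + (\<theta> * x i + \<beta> / 2) * ?k i"
        unfolding w s(2) using m assms(2) by (simp add: field_simps power2_eq_square)
    qed
    also have "\<dots> = (\<Sum>i=1..n. m * (\<omega>2 / 4 + \<omega>1 / 8)) - (\<Sum>(i, j)\<in>pairs n. \<theta> / 2 * ((x i)\<^sup>2 + (x j)\<^sup>2))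
        + (\<Sum>(i, j)\<in>pairs n. spin g i j * (\<theta> * (x i + x j) + \<beta>))"
    proof -
      \<comment> \<open>The factor \<open>m\<close> is the number of pairs through a vertex.\<close>
      have "(\<Sum>i=1..n. m * (\<theta> / 2 * (x i)\<^sup>2)) = (\<Sum>(i, j)\<in>pairs n. \<theta> / 2 * ((x i)\<^sup>2 + (x j)\<^sup>2))"
        using sum_pairs_add[of "\<lambda>i. \<theta> / 2 * (x i)\<^sup>2" n]
        by (simp add: m_def sum_distrib_left distrib_left)
      \<comment> \<open>The two ends of an edge contribute \<open>\<beta> / 2\<close> each.\<close>
      moreover have "(\<Sum>i=1..n. (\<theta> * x i + \<beta> / 2) * ?k i) = (\<Sum>(i, j)\<in>pairs n. spin g i j * (\<theta> * (x i + x j) + \<beta>))"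
        unfolding sum_row_sum_spin[OF g] by (intro sum.cong refl) (auto simp: algebra_simps)
      ultimately show ?thesis
        by (simp add: sum.distrib sum_subtractf)
    qed
    finally have exponent: "exp (\<Sum>i=1..n. m * (\<omega>2 / 4 + \<omega>1 / 8) + (\<omega>1 + \<omega>2) / 4 * ?k i + \<omega>1 / (8 * m) * (?k i)\<^sup>2)
        * exp (\<Sum>i=1..n. - (x i - ?k i / m)\<^sup>2 / (2 * \<sigma>\<^sup>2))
      = exp (\<Sum>i=1..n. m * (\<omega>2 / 4 + \<omega>1 / 8)) * exp (- (\<Sum>(i, j)\<in>pairs n. \<theta> / 2 * ((x i)\<^sup>2 + (x j)\<^sup>2)))
        * exp (\<Sum>(i, j)\<in>pairs n. spin g i j * (\<theta> * (x i + x j) + \<beta>))"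
      by (simp flip: exp_add)
    have "two_star_prob n \<omega>1 \<omega>2 g * (\<Prod>i=1..n. normal_density (?k i / m) \<sigma> (x i))
      = exp (\<Sum>i=1..n. m * (\<omega>2 / 4 + \<omega>1 / 8) + (\<omega>1 + \<omega>2) / 4 * ?k i + \<omega>1 / (8 * m) * (?k i)\<^sup>2)
        * exp (\<Sum>i=1..n. - (x i - ?k i / m)\<^sup>2 / (2 * \<sigma>\<^sup>2)) * ((1 / sqrt (2 * pi * \<sigma>\<^sup>2)) ^ n / two_star_Z n \<omega>1 \<omega>2)"
      unfolding two_star_prob_def two_star_weight_row_sum[OF assms(1) g] normal_density_def prod.distrib m_def[symmetric]
      by (simp add: exp_sum)
    then show ?thesis
      unfolding exponent D_def by (simp add: exp_sum split_def)
  qed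
  ultimately show ?thesis
    unfolding m_def \<sigma>_def by blast
qed

section \<open>Finite mixtures and Bayes' formula\<close>

text \<open>Here \<open>h\<close> is the joint density of \<open>X\<close> and \<open>\<phi>\<close>
  with respect to counting measure times \<open>N\<close>. Splitting an event by the finitely many
  values of \<open>X\<close> gives the first claim; taking all of \<open>S\<close> gives the
  marginal density of \<open>\<phi>\<close>.\<close>

lemma (in prob_space) finite_mixture_distributed:
  fixes h :: "'s \<Rightarrow> 'b \<Rightarrow> real"
  assumes "finite S" and X [measurable]: "X \<in> measurable M (count_space S)"
    and \<phi> [measurable]: "\<phi> \<in> measurable M N"
    and h [measurable]: "\<And>s. s \<in> S \<Longrightarrow> h s \<in> borel_measurable N"
    and nonneg: "\<And>s x. s \<in> S \<Longrightarrow> 0 \<le> h s x"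
    and joint: "\<And>s A. s \<in> S \<Longrightarrow> A \<in> sets N \<Longrightarrow>
      emeasure M {\<omega> \<in> space M. X \<omega> = s \<and> \<phi> \<omega> \<in> A} = (\<integral>\<^sup>+x\<in>A. h s x \<partial>N)"
  shows "C \<subseteq> S \<Longrightarrow> A \<in> sets N \<Longrightarrow>
      emeasure M {\<omega> \<in> space M. X \<omega> \<in> C \<and> \<phi> \<omega> \<in> A} = (\<integral>\<^sup>+x\<in>A. (\<Sum>s\<in>C. h s x) \<partial>N)"
    and "distributed M N \<phi> (\<lambda>x. ennreal (\<Sum>s\<in>S. h s x))"
proof -
  show part: "emeasure M {\<omega> \<in> space M. X \<omega> \<in> C \<and> \<phi> \<omega> \<in> A} = (\<integral>\<^sup>+x\<in>A. (\<Sum>s\<in>C. h s x) \<partial>N)"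
    if C: "C \<subseteq> S" and A [measurable]: "A \<in> sets N" for C A
  proof -
    have fin: "finite C" using C \<open>finite S\<close> finite_subset by blast
    have [measurable]: "{\<omega> \<in> space M. X \<omega> = s \<and> \<phi> \<omega> \<in> A} \<in> sets M" if "s \<in> S" for s
      using that by measurable
    have "{\<omega> \<in> space M. X \<omega> \<in> C \<and> \<phi> \<omega> \<in> A} = (\<Union>s\<in>C. {\<omega> \<in> space M. X \<omega> = s \<and> \<phi> \<omega> \<in> A})"
      by auto
    also have "emeasure M \<dots> = (\<Sum>s\<in>C. emeasure M {\<omega> \<in> space M. X \<omega> = s \<and> \<phi> \<omega> \<in> A})"
      using C by (intro sum_emeasure[symmetric] fin) (auto simp: disjoint_family_on_def)
    also have "\<dots> = (\<Sum>s\<in>C. \<integral>\<^sup>+x\<in>A. h s x \<partial>N)"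
      using C by (intro sum.cong refl joint) auto
    also have "\<dots> = (\<integral>\<^sup>+x. (\<Sum>s\<in>C. ennreal (h s x) * indicator A x) \<partial>N)"
      using C by (intro nn_integral_sum[symmetric]) auto
    also have "\<dots> = (\<integral>\<^sup>+x\<in>A. (\<Sum>s\<in>C. h s x) \<partial>N)"
      using C nonneg by (intro nn_integral_cong) (simp add: sum_distrib_right[symmetric] subset_eq)
    finally show ?thesis .
  qed
  show "distributed M N \<phi> (\<lambda>x. ennreal (\<Sum>s\<in>S. h s x))"
    unfolding distributed_def
  proof (intro conjI measure_eqI)
    fix A assume "A \<in> sets (distr M N \<phi>)"
    then have A [measurable]: "A \<in> sets N" by simp
    have "\<phi> -` A \<inter> space M = {\<omega> \<in> space M. X \<omega> \<in> S \<and> \<phi> \<omega> \<in> A}"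
      using measurable_space[OF X] by auto
    then show "emeasure (distr M N \<phi>) A = emeasure (density N (\<lambda>x. ennreal (\<Sum>s\<in>S. h s x))) A"
      using part[OF subset_refl A] by (simp add: emeasure_distr emeasure_density)
  qed auto
qed

text \<open>Bayes' formula. The ratio is a function of \<open>\<phi>\<close>, and integrating it
  against the marginal density cancels the denominator and leaves the joint probability. These two
  facts characterize the conditional expectation almost surely.\<close>

lemma (in prob_space) cprob_finite_mixture:
  fixes h :: "'s \<Rightarrow> 'b \<Rightarrow> real"
  assumes fin: "finite S" and X [measurable]: "X \<in> measurable M (count_space S)"
    and \<phi> [measurable]: "\<phi> \<in> measurable M N"
    and h [measurable]: "\<And>s. s \<in> S \<Longrightarrow> h s \<in> borel_measurable N"
    and nonneg: "\<And>s x. s \<in> S \<Longrightarrow> 0 \<le> h s x"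
    and pos: "\<And>x. 0 < (\<Sum>s\<in>S. h s x)"
    and joint: "\<And>s A. s \<in> S \<Longrightarrow> A \<in> sets N \<Longrightarrow>
      emeasure M {\<omega> \<in> space M. X \<omega> = s \<and> \<phi> \<omega> \<in> A} = (\<integral>\<^sup>+x\<in>A. h s x \<partial>N)"
    and C: "C \<subseteq> S"
  shows "AE \<omega> in M. cprob M (gen_sigma M \<phi> N) {\<omega> \<in> space M. X \<omega> \<in> C} \<omega>
           = (\<Sum>s\<in>C. h s (\<phi> \<omega>)) / (\<Sum>s\<in>S. h s (\<phi> \<omega>))"
proof -
  define F where "F = gen_sigma M \<phi> N"
  define r where "r x = (\<Sum>s\<in>C. h s x) / (\<Sum>s\<in>S. h s x)" for x
  have \<phi>_space: "\<phi> \<in> space M \<rightarrow> space N"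
    using measurable_space[OF \<phi>] by auto
  have sets_F: "sets F = {\<phi> -` A \<inter> space M | A. A \<in> sets N}"
    unfolding F_def gen_sigma_def by (rule sets_vimage_algebra2[OF \<phi>_space])
  have sub: "subalgebra M F"
    unfolding subalgebra_def sets_F by (auto simp: F_def gen_sigma_def)
  interpret finite_measure_subalgebra M F
    by standard (rule sub)
  have r_borel [measurable]: "r \<in> borel_measurable N"
    unfolding r_def using C by (intro borel_measurable_divide borel_measurable_sum) auto
  have hC: "0 \<le> (\<Sum>s\<in>C. h s x)" "(\<Sum>s\<in>C. h s x) \<le> (\<Sum>s\<in>S. h s x)" for x
    using C nonneg fin by (auto intro!: sum_nonneg sum_mono2)
  have r_range: "0 \<le> r x" "r x \<le> 1" for x
    using hC[of x] pos[of x] by (auto simp: r_def)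
  have C_sets [measurable]: "{\<omega> \<in> space M. X \<omega> \<in> C} \<in> sets M"
  proof -
    have "X -` C \<inter> space M \<in> sets M" using C by (intro measurable_sets[OF X]) auto
    then show ?thesis by (simp add: vimage_def Int_def conj_commute)
  qed
  have int_r: "integrable M (\<lambda>\<omega>. r (\<phi> \<omega>))"
    using r_range by (intro integrable_const_bound[where B = 1]) auto
  note dist = finite_mixture_distributed(2)[OF fin X \<phi> h nonneg joint]
  have "AE \<omega> in M. real_cond_exp M F (indicator {\<omega> \<in> space M. X \<omega> \<in> C}) \<omega> = r (\<phi> \<omega>)"
  proof (rule real_cond_exp_charact)
    fix B assume "B \<in> sets F"
    then obtain A where A [measurable]: "A \<in> sets N" and B: "B = \<phi> -` A \<inter> space M"
      by (auto simp: sets_F)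
    have [measurable]: "B \<in> sets M" unfolding B by measurable
    \<comment> \<open>The identity is checked in \<open>ennreal\<close>, where integrals of
      nonnegative functions pass to the density of \<open>\<phi>\<close>; nonnegativity of both
      sides carries it back to the reals.\<close>
    have "ennreal (\<integral>\<omega>\<in>B. r (\<phi> \<omega>) \<partial>M) = (\<integral>\<^sup>+\<omega>. ennreal (indicator B \<omega> * r (\<phi> \<omega>)) \<partial>M)"
      unfolding set_lebesgue_integral_def using r_range integrable_mult_indicator[OF \<open>B \<in> sets M\<close> int_r]
      by (subst nn_integral_eq_integral) auto
    also have "\<dots> = (\<integral>\<^sup>+\<omega>. ennreal (r (\<phi> \<omega>)) * indicator A (\<phi> \<omega>) \<partial>M)"
      by (intro nn_integral_cong) (auto simp: B indicator_def)
    also have "\<dots> = (\<integral>\<^sup>+x. ennreal (\<Sum>s\<in>S. h s x) * (ennreal (r x) * indicator A x) \<partial>N)"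
      using A r_borel by (intro distributed_nn_integral[OF dist, symmetric]) (auto intro!: borel_measurable_times_ennreal)
    also have "\<dots> = (\<integral>\<^sup>+x\<in>A. (\<Sum>s\<in>C. h s x) \<partial>N)"
    proof (rule nn_integral_cong)
      fix x
      have "(\<Sum>s\<in>S. h s x) * r x = (\<Sum>s\<in>C. h s x)"
        using pos[of x] by (simp add: r_def)
      then show "ennreal (\<Sum>s\<in>S. h s x) * (ennreal (r x) * indicator A x) = ennreal (\<Sum>s\<in>C. h s x) * indicator A x"
        using pos[of x] r_range[of x] by (simp add: mult.assoc[symmetric] ennreal_mult[symmetric] less_imp_le)
    qed
    also have "\<dots> = emeasure M {\<omega> \<in> space M. X \<omega> \<in> C \<and> \<phi> \<omega> \<in> A}"
      by (rule finite_mixture_distributed(1)[OF fin X \<phi> h nonneg joint C A, symmetric])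
    also have "{\<omega> \<in> space M. X \<omega> \<in> C \<and> \<phi> \<omega> \<in> A} = B \<inter> {\<omega> \<in> space M. X \<omega> \<in> C}"
      by (auto simp: B)
    finally have "ennreal (\<integral>\<omega>\<in>B. r (\<phi> \<omega>) \<partial>M) = ennreal (prob (B \<inter> {\<omega> \<in> space M. X \<omega> \<in> C}))"
      by (simp add: emeasure_eq_measure)
    moreover have "0 \<le> (\<integral>\<omega>\<in>B. r (\<phi> \<omega>) \<partial>M)"
      unfolding set_lebesgue_integral_def using r_range by (intro integral_nonneg_AE) auto
    ultimately have "(\<integral>\<omega>\<in>B. r (\<phi> \<omega>) \<partial>M) = prob (B \<inter> {\<omega> \<in> space M. X \<omega> \<in> C})"
      by (simp add: ennreal_inj)
    then show "(\<integral>\<omega>\<in>B. indicator {\<omega> \<in> space M. X \<omega> \<in> C} \<omega> \<partial>M) = (\<integral>\<omega>\<in>B. r (\<phi> \<omega>) \<partial>M)"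
      by (simp add: set_lebesgue_integral_def indicator_inter_arith[symmetric])
  next
    show "integrable M (indicator {\<omega> \<in> space M. X \<omega> \<in> C} :: 'a \<Rightarrow> real)"
      using C_sets by (simp add: integrable_indicator_iff emeasure_eq_measure)
    have "\<phi> \<in> measurable F N"
      unfolding F_def gen_sigma_def by (rule measurable_vimage_algebra1[OF \<phi>_space])
    then show "(\<lambda>\<omega>. r (\<phi> \<omega>)) \<in> borel_measurable F" by measurable
  qed (rule int_r)
  then show ?thesis unfolding cprob_def r_def F_def .
qed

section \<open>Densities of independent vectors\<close>

text \<open>A product measure is determined by its values on boxes, and there the integral of the
  product density factorizes.\<close>

lemma density_PiM:
  fixes N :: "'i \<Rightarrow> 'b measure"
  assumes fin: "finite I" and sf: "\<And>i. sigma_finite_measure (N i)"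
    and f [measurable]: "\<And>i. i \<in> I \<Longrightarrow> f i \<in> borel_measurable (N i)"
    and prob: "\<And>i. i \<in> I \<Longrightarrow> prob_space (density (N i) (f i))"
  shows "PiM I (\<lambda>i. density (N i) (f i)) = density (PiM I N) (\<lambda>x. \<Prod>i\<in>I. f i (x i))"
proof -
  \<comment> \<open>\<open>product_sigma_finite\<close> speaks of every index, but the densities are
    controlled only on \<open>I\<close>. A point mass fills the other indices without changing the
    product over \<open>I\<close>.\<close>
  let ?N = "\<lambda>i. if i \<in> I then density (N i) (f i) else return (count_space UNIV) undefined"
  interpret N: product_sigma_finite N by (simp add: product_sigma_finite_def sf)
  interpret D: product_sigma_finite ?N
    by (auto simp: product_sigma_finite_def intro!: prob_space_imp_sigma_finite prob prob_space_return)
  have eq: "PiM I ?N = PiM I (\<lambda>i. density (N i) (f i))"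
    by (rule PiM_cong) auto
  have "density (PiM I N) (\<lambda>x. \<Prod>i\<in>I. f i (x i)) = PiM I ?N"
  proof (rule D.PiM_eqI[OF fin])
    show "sets (density (PiM I N) (\<lambda>x. \<Prod>i\<in>I. f i (x i))) = sets (PiM I ?N)"
      unfolding eq sets_density by (rule sets_PiM_cong) auto
  next
    fix A assume A: "\<And>i. i \<in> I \<Longrightarrow> A i \<in> sets (?N i)"
    then have A' [measurable]: "\<And>i. i \<in> I \<Longrightarrow> A i \<in> sets (N i)" by simp
    have "emeasure (density (PiM I N) (\<lambda>x. \<Prod>i\<in>I. f i (x i))) (Pi\<^sub>E I A)
        = (\<integral>\<^sup>+x. (\<Prod>i\<in>I. f i (x i)) * indicator (Pi\<^sub>E I A) x \<partial>PiM I N)"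
      using fin by (subst emeasure_density) (auto intro!: sets_PiM_I_finite)
    also have "\<dots> = (\<integral>\<^sup>+x. (\<Prod>i\<in>I. f i (x i) * indicator (A i) (x i)) \<partial>PiM I N)"
    proof (rule nn_integral_cong)
      fix x assume "x \<in> space (PiM I N)"
      \<comment> \<open>Extensionality reduces membership in the box to the coordinates in
        \<open>I\<close>, so the indicator of the box is a product.\<close>
      then have "x \<in> extensional I" by (simp add: space_PiM PiE_def)
      then have "indicator (Pi\<^sub>E I A) x = (\<Prod>i\<in>I. indicator (A i) (x i) :: ennreal)"
        using fin by (cases "\<forall>i\<in>I. x i \<in> A i") (simp_all add: PiE_iff indicator_def)
      then show "(\<Prod>i\<in>I. f i (x i)) * indicator (Pi\<^sub>E I A) x = (\<Prod>i\<in>I. f i (x i) * indicator (A i) (x i))"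
        by (simp add: prod.distrib)
    qed
    also have "\<dots> = (\<Prod>i\<in>I. \<integral>\<^sup>+x. f i x * indicator (A i) x \<partial>N i)"
      by (rule N.product_nn_integral_prod[OF fin]) measurable
    also have "\<dots> = (\<Prod>i\<in>I. emeasure (?N i) (A i))"
      by (intro prod.cong refl) (simp add: emeasure_density)
    finally show "emeasure (density (PiM I N) (\<lambda>x. \<Prod>i\<in>I. f i (x i))) (Pi\<^sub>E I A) = (\<Prod>i\<in>I. emeasure (?N i) (A i))" .
  qed
  then show ?thesis by (simp add: eq)
qed

text \<open>Independence makes the joint law the product of the marginal laws, and
  \<open>density_PiM\<close> merges their densities.\<close>

lemma (in prob_space) distributed_indep_vars_PiM:
  fixes N :: "'i \<Rightarrow> 'b measure"
  assumes fin: "finite I" "I \<noteq> {}" and sf: "\<And>i. sigma_finite_measure (N i)"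
    and indep: "indep_vars N X I"
    and dist: "\<And>i. i \<in> I \<Longrightarrow> distributed M (N i) (X i) (f i)"
  shows "distributed M (PiM I N) (\<lambda>\<omega>. \<lambda>i\<in>I. X i \<omega>) (\<lambda>x. \<Prod>i\<in>I. f i (x i))"
  unfolding distributed_def
proof (intro conjI)
  have X: "X i \<in> measurable M (N i)" and f: "f i \<in> borel_measurable (N i)"
    and eq: "distr M (N i) (X i) = density (N i) (f i)" if "i \<in> I" for i
    using dist[OF that] by (auto simp: distributed_def)
  show "(\<lambda>\<omega>. \<lambda>i\<in>I. X i \<omega>) \<in> measurable M (PiM I N)"
    using X by (rule measurable_restrict)
  show "(\<lambda>x. \<Prod>i\<in>I. f i (x i)) \<in> borel_measurable (PiM I N)"
    using f by measurable
  have "distr M (PiM I N) (\<lambda>\<omega>. \<lambda>i\<in>I. X i \<omega>) = (\<Pi>\<^sub>M i\<in>I. distr M (N i) (X i))"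
    using indep_vars_iff_distr_eq_PiM'[OF fin(2) X] indep by simp
  also have "\<dots> = (\<Pi>\<^sub>M i\<in>I. density (N i) (f i))"
    by (rule PiM_cong) (auto simp: eq)
  also have "\<dots> = density (PiM I N) (\<lambda>x. \<Prod>i\<in>I. f i (x i))"
    using prob_space_distr[OF X] by (intro density_PiM fin sf f) (simp_all flip: eq)
  finally show "distr M (PiM I N) (\<lambda>\<omega>. \<lambda>i\<in>I. X i \<omega>) = density (PiM I N) (\<lambda>x. \<Prod>i\<in>I. f i (x i))" .
qed

section \<open>Factorization of edge weights\<close>

lemma sum_graphs_prod_exp:
  fixes a :: "nat \<times> nat \<Rightarrow> real"
  shows "(\<Sum>g\<in>graphs n. \<Prod>(i, j)\<in>pairs n. exp (spin g i j * a (i, j))) = (\<Prod>p\<in>pairs n. exp (a p) + exp (- a p))"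
  using sum_graphs_prod_pairs[where n = n and f = "\<lambda>p y. exp (y * a p)"]
  by (simp add: split_def)

text \<open>The law of a single spin with values 1 and -1 in an external field \<open>a\<close>. At
  \<open>A = {1}\<close> it is the logistic expression of claim (a).\<close>

definition spin_prob :: "real set \<Rightarrow> real \<Rightarrow> real" where
  "spin_prob A a = (indicator A 1 * exp a + indicator A (-1) * exp (- a)) / (exp a + exp (- a))"

text \<open>Numerator and denominator both factorize over all edges, and an edge outside
  \<open>J\<close> contributes the same factor to each. So the spins behave like independent ones
  with law \<open>spin_prob\<close>.\<close>

lemma spin_cylinder_ratio:
  fixes a :: "nat \<times> nat \<Rightarrow> real"
  assumes "J \<subseteq> pairs n"
  shows "(\<Sum>g\<in>{g \<in> graphs n. \<forall>(i, j)\<in>J. spin g i j \<in> A (i, j)}. \<Prod>(i, j)\<in>pairs n. exp (spin g i j * a (i, j)))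
       / (\<Sum>g\<in>graphs n. \<Prod>(i, j)\<in>pairs n. exp (spin g i j * a (i, j)))
     = (\<Prod>p\<in>J. spin_prob (A p) (a p))"
proof -
  \<comment> \<open>Padding with \<open>UNIV\<close> writes the constraint on \<open>J\<close> as a
    product of indicators over all pairs; a graph that violates it then contributes 0.\<close>
  let ?A = "\<lambda>p. if p \<in> J then A p else UNIV"
  have "(\<Sum>g\<in>{g \<in> graphs n. \<forall>(i, j)\<in>J. spin g i j \<in> A (i, j)}. \<Prod>(i, j)\<in>pairs n. exp (spin g i j * a (i, j)))
      = (\<Sum>g\<in>graphs n. \<Prod>p\<in>pairs n. indicator (?A p) (case p of (i, j) \<Rightarrow> spin g i j)
            * exp ((case p of (i, j) \<Rightarrow> spin g i j) * a p))"
  proof (rule sum.mono_neutral_cong_left)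
    show "\<forall>g\<in>graphs n - {g \<in> graphs n. \<forall>(i, j)\<in>J. spin g i j \<in> A (i, j)}.
        (\<Prod>p\<in>pairs n. indicator (?A p) (case p of (i, j) \<Rightarrow> spin g i j)
            * exp ((case p of (i, j) \<Rightarrow> spin g i j) * a p)) = 0"
    proof
      fix g assume "g \<in> graphs n - {g \<in> graphs n. \<forall>(i, j)\<in>J. spin g i j \<in> A (i, j)}"
      then obtain i j where "(i, j) \<in> J" "spin g i j \<notin> A (i, j)" by blast
      then show "(\<Prod>p\<in>pairs n. indicator (?A p) (case p of (i, j) \<Rightarrow> spin g i j)
            * exp ((case p of (i, j) \<Rightarrow> spin g i j) * a p)) = 0"
        using assms by (intro prod_zero bexI[of _ "(i, j)"]) auto
    qed
  qed (auto intro!: prod.cong simp: indicator_def)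
  also have "\<dots> = (\<Prod>p\<in>pairs n. indicator (?A p) 1 * exp (a p) + indicator (?A p) (- 1) * exp (- a p))"
    by (subst sum_graphs_prod_pairs) simp
  finally have num: "(\<Sum>g\<in>{g \<in> graphs n. \<forall>(i, j)\<in>J. spin g i j \<in> A (i, j)}. \<Prod>(i, j)\<in>pairs n. exp (spin g i j * a (i, j)))
      = (\<Prod>p\<in>pairs n. indicator (?A p) 1 * exp (a p) + indicator (?A p) (- 1) * exp (- a p))" .
  have "(\<Prod>p\<in>pairs n. indicator (?A p) 1 * exp (a p) + indicator (?A p) (- 1) * exp (- a p)) / (\<Prod>p\<in>pairs n. exp (a p) + exp (- a p))
      = (\<Prod>p\<in>pairs n. spin_prob (?A p) (a p))"
    unfolding spin_prob_def by (rule prod_dividef[symmetric])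
  also have "\<dots> = (\<Prod>p\<in>J. spin_prob (?A p) (a p))"
  proof (rule prod.mono_neutral_right)
    \<comment> \<open>With \<open>UNIV\<close> the numerator and denominator of
      \<open>spin_prob\<close> agree, so the value is 1 once the denominator is nonzero.\<close>
    have "exp x + exp (- x) \<noteq> 0" for x :: real
      using add_pos_pos[OF exp_gt_zero exp_gt_zero] less_irrefl by metis
    then show "\<forall>p\<in>pairs n - J. spin_prob (?A p) (a p) = 1"
      by (simp add: spin_prob_def)
  qed (use assms in auto)
  also have "\<dots> = (\<Prod>p\<in>J. spin_prob (A p) (a p))"
    by simp
  finally show ?thesis unfolding num sum_graphs_prod_exp .
qed

text \<open>Each edge factor is \<open>2 * cosh (a p)\<close>. It is written through
  \<open>ln\<close> to match \<open>f_fun\<close>; the power of 2 goes into the normalizing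
  constant.\<close>

lemma sum_graphs_eq_cosh:
  fixes a :: "nat \<times> nat \<Rightarrow> real"
  shows "(\<Sum>g\<in>graphs n. \<Prod>(i, j)\<in>pairs n. exp (spin g i j * a (i, j)))
    = 2 ^ card (pairs n) * exp (\<Sum>p\<in>pairs n. ln (cosh (a p)))"
proof -
  have "(\<Sum>g\<in>graphs n. \<Prod>(i, j)\<in>pairs n. exp (spin g i j * a (i, j))) = (\<Prod>p\<in>pairs n. exp (a p) + exp (- a p))"
    by (rule sum_graphs_prod_exp)
  also have "\<dots> = (\<Prod>p\<in>pairs n. 2 * exp (ln (cosh (a p))))"
    \<comment> \<open>Positivity of \<open>cosh\<close> first cancels \<open>exp\<close> against
      \<open>ln\<close>; only then is \<open>cosh\<close> unfolded.\<close>
    by (intro prod.cong refl) (simp add: cosh_real_pos, simp add: cosh_def)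
  finally show ?thesis
    by (simp add: prod.distrib exp_sum)
qed

text \<open>Makes every event \<open>G \<omega> = g\<close> an event of the spins, for which
  independence from \<open>W\<close> is assumed.\<close>

lemma spin_inject:
  assumes "g \<in> graphs n" "g' \<in> graphs n" "spin g = spin g'"
  shows "g = g'"
proof (intro ext)
  fix i j
  show "g i j = g' i j"
    using assms(1,2) fun_cong[OF fun_cong[OF assms(3)], of i j]
    by (auto simp: graphs_def spin_def split: if_splits)
qed

text \<open>Uses \<open>x\<^sup>2 + y\<^sup>2 = ((x - y)\<^sup>2 + (x + y)\<^sup>2) / 2\<close>; the
  argument of \<open>cosh\<close> depends on the midpoint alone.\<close>

lemma p_fun_eq_q_fun: "p_fun \<theta> \<beta> x y = \<theta> / 4 * (x - y)\<^sup>2 + q_fun \<theta> \<beta> ((x + y) / 2)"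
proof -
  have "2 * \<theta> * ((x + y) / 2) + \<beta> = \<theta> * (x + y) + \<beta>" by simp
  then show ?thesis
    unfolding p_fun_def q_fun_def by (simp only:) (simp add: field_simps power2_eq_square)
qed

section \<open>The joint law of \<open>G\<close> and \<open>\<phi>\<close>\<close>

text \<open>On the event \<open>G \<omega> = g\<close> the vector \<open>\<phi>\<close> is a fixed
  affine image of \<open>W\<close>. Independence then splits the probability into that of
  \<open>g\<close> and an integral of a product of normal densities.\<close>

lemma (in prob_space) two_star_joint_law:
  assumes n: "n \<ge> 2" and \<theta>: "\<theta> > 0"
    and G: "distributed M (count_space (graphs n)) G (\<lambda>g. ennreal (two_star_prob n \<omega>1 \<omega>2 g))"
    and indep: "indep_vars (\<lambda>_. borel) W {1..n}"
    and W: "\<And>i. i \<in> {1..n} \<Longrightarrow> distributed M lborel (W i) (\<lambda>x. ennreal (std_normal_density x))"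
    and GW: "indep_set
           (sets (gen_sigma M (\<lambda>\<omega>. spin (G \<omega>)) (count_space UNIV)))
           (sets (gen_sigma M (\<lambda>\<omega>. \<lambda>i\<in>{1..n}. W i \<omega>) (Pi\<^sub>M {1..n} (\<lambda>_. borel))))"
    and \<phi>: "\<phi> = (\<lambda>\<omega>. \<lambda>i\<in>{1..n}. row_sum n (spin (G \<omega>)) i / (real n - 1)
                              + W i \<omega> / sqrt ((real n - 1) * \<theta>))"
    and g: "g \<in> graphs n" and A [measurable]: "A \<in> sets (Pi\<^sub>M {1..n} (\<lambda>_. lborel))"
  shows "emeasure M {\<omega> \<in> space M. G \<omega> = g \<and> \<phi> \<omega> \<in> A} =
    (\<integral>\<^sup>+x\<in>A. ennreal (two_star_prob n \<omega>1 \<omega>2 g * (\<Prod>i=1..n. normal_density (row_sum n (spin g) i / (real n - 1)) (1 / sqrt ((real n - 1) * \<theta>)) (x i)))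
       \<partial>Pi\<^sub>M {1..n} (\<lambda>_. lborel))"
proof -
  define \<sigma> where "\<sigma> = 1 / sqrt ((real n - 1) * \<theta>)"
  define \<mu> where "\<mu> i = row_sum n (spin g) i / (real n - 1)" for i
  \<comment> \<open>\<open>T\<close> sends the noise vector to \<open>\<phi>\<close> when the graph
    is \<open>g\<close>.\<close>
  define T where "T x = (\<lambda>i\<in>{1..n}. \<mu> i + \<sigma> * x i)" for x :: "nat \<Rightarrow> real"
  let ?W = "\<lambda>\<omega>. \<lambda>i\<in>{1..n}. W i \<omega>"
  let ?L = "Pi\<^sub>M {1..n} (\<lambda>_. lborel :: real measure)" and ?B = "Pi\<^sub>M {1..n} (\<lambda>_. borel :: real measure)"
  have sets_LB: "sets ?L = sets ?B" by (rule sets_PiM_cong) auto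
  have \<sigma>: "\<sigma> > 0" using n \<theta> by (simp add: \<sigma>_def)
  have G_meas: "G \<in> measurable M (count_space (graphs n))" using G by (simp add: distributed_def)
  have AB: "A \<in> sets ?B" using A sets_LB by simp
  have T_meas [measurable]: "T \<in> measurable ?B ?B" unfolding T_def by measurable
  have W_meas: "W i \<in> borel_measurable M" if "i \<in> {1..n}" for i
    using W[OF that] by (auto simp: distributed_def)
  have W_space: "?W \<in> space M \<rightarrow> space ?B" by (auto simp: space_PiM)

  have Z: "distributed M lborel (\<lambda>\<omega>. \<mu> i + \<sigma> * W i \<omega>) (\<lambda>x. ennreal (normal_density (\<mu> i) \<sigma> x))" if "i \<in> {1..n}" for i
    using normal_density_affine[OF W[OF that], of \<sigma> "\<mu> i"] \<sigma> by simp
  have "indep_vars (\<lambda>_. lborel) (\<lambda>i \<omega>. \<mu> i + \<sigma> * W i \<omega>) {1..n}"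
    by (rule indep_vars_compose2[OF indep]) simp
  then have TW: "distributed M ?L (\<lambda>\<omega>. \<lambda>i\<in>{1..n}. \<mu> i + \<sigma> * W i \<omega>) (\<lambda>x. \<Prod>i=1..n. ennreal (normal_density (\<mu> i) \<sigma> (x i)))"
    using n Z by (intro distributed_indep_vars_PiM) (auto intro: lborel.sigma_finite_measure_axioms)

  \<comment> \<open>Independence concerns events generated by the noise vector, so \<open>A\<close>
    is pulled back through \<open>T\<close> first.\<close>
  let ?E = "G -` {g} \<inter> space M" and ?H = "?W -` (T -` A \<inter> space ?B) \<inter> space M"
  have H_eq: "?H = (\<lambda>\<omega>. \<lambda>i\<in>{1..n}. \<mu> i + \<sigma> * W i \<omega>) -` A \<inter> space M"
    using W_space by (auto simp: T_def space_PiM cong: restrict_cong)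
  have "{\<omega> \<in> space M. G \<omega> = g \<and> \<phi> \<omega> \<in> A} = ?E \<inter> ?H"
    unfolding H_eq by (auto simp: \<phi> \<mu>_def \<sigma>_def)
  moreover have "prob (?E \<inter> ?H) = prob ?E * prob ?H"
  proof (rule indep_setD[OF GW])
    have "?E = (\<lambda>\<omega>. spin (G \<omega>)) -` {spin g} \<inter> space M"
      using spin_inject[OF _ g] measurable_space[OF G_meas] by auto
    then show "?E \<in> sets (gen_sigma M (\<lambda>\<omega>. spin (G \<omega>)) (count_space UNIV))"
      unfolding gen_sigma_def by (simp add: in_vimage_algebra)
    show "?H \<in> sets (gen_sigma M ?W ?B)"
      unfolding gen_sigma_def by (intro in_vimage_algebra measurable_sets[OF T_meas AB])
  qed
  ultimately have "emeasure M {\<omega> \<in> space M. G \<omega> = g \<and> \<phi> \<omega> \<in> A} = emeasure M ?E * emeasure M ?H"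
    by (simp add: emeasure_eq_measure ennreal_mult)
  also have "emeasure M ?E = ennreal (two_star_prob n \<omega>1 \<omega>2 g)"
    by (rule distributed_count_space[OF G g finite_graphs, symmetric])
  also have "emeasure M ?H = (\<integral>\<^sup>+x\<in>A. (\<Prod>i=1..n. ennreal (normal_density (\<mu> i) \<sigma> (x i))) \<partial>?L)"
    unfolding H_eq by (rule distributed_emeasure[OF TW A])
  also have "ennreal (two_star_prob n \<omega>1 \<omega>2 g) * \<dots>
      = (\<integral>\<^sup>+x. ennreal (two_star_prob n \<omega>1 \<omega>2 g) * ((\<Prod>i=1..n. ennreal (normal_density (\<mu> i) \<sigma> (x i))) * indicator A x) \<partial>?L)"
    by (rule nn_integral_cmult[symmetric]) measurable
  also have "\<dots> = (\<integral>\<^sup>+x\<in>A. ennreal (two_star_prob n \<omega>1 \<omega>2 g * (\<Prod>i=1..n. normal_density (\<mu> i) \<sigma> (x i))) \<partial>?L)"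
    using two_star_prob_nonneg by (intro nn_integral_cong) (simp add: prod_ennreal ennreal_mult prod_nonneg mult.assoc)
  finally show ?thesis unfolding \<mu>_def \<sigma>_def .
qed

section \<open>Conditional independence and the density of \<open>\<phi>\<close>\<close>

theorem proposition1p1:
  fixes M :: "'a measure" and n :: nat and \<theta> \<beta> \<omega>1 \<omega>2 :: real
    and G :: "'a \<Rightarrow> nat \<Rightarrow> nat \<Rightarrow> nat" and Y :: "'a \<Rightarrow> nat \<Rightarrow> nat \<Rightarrow> real"
    and W :: "nat \<Rightarrow> 'a \<Rightarrow> real" and \<phi> :: "'a \<Rightarrow> nat \<Rightarrow> real"
  assumes "prob_space M"
    and "n \<ge> 2" and "\<theta> > 0" and "\<theta> = \<omega>1 / 4" and "\<beta> = (\<omega>1 + \<omega>2) / 2"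
    and "distributed M (count_space (graphs n)) G (\<lambda>g. ennreal (two_star_prob n \<omega>1 \<omega>2 g))"
    and "Y = (\<lambda>\<omega>. spin (G \<omega>))"
    and "prob_space.indep_vars M (\<lambda>_. borel) W {1..n}"
    and "\<And>i. i \<in> {1..n} \<Longrightarrow> distributed M lborel (W i) (\<lambda>x. ennreal (std_normal_density x))"
    and "prob_space.indep_set M
           (sets (gen_sigma M Y (count_space UNIV)))
           (sets (gen_sigma M (\<lambda>\<omega>. \<lambda>i\<in>{1..n}. W i \<omega>) (Pi\<^sub>M {1..n} (\<lambda>_. borel))))"
    and "\<phi> = (\<lambda>\<omega>. \<lambda>i\<in>{1..n}. row_sum n (Y \<omega>) i / (real n - 1)
                              + W i \<omega> / sqrt ((real n - 1) * \<theta>))"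
  shows "cond_indep_vars M (gen_sigma M \<phi> (Pi\<^sub>M {1..n} (\<lambda>_. borel)))
           (\<lambda>_. borel) (\<lambda>(i, j) \<omega>. Y \<omega> i j) (pairs n)
       \<and> (\<forall>(i, j)\<in>pairs n. AE \<omega> in M.
            cprob M (gen_sigma M \<phi> (Pi\<^sub>M {1..n} (\<lambda>_. borel))) {\<omega> \<in> space M. Y \<omega> i j = 1} \<omega>
            = exp (\<theta> * (\<phi> \<omega> i + \<phi> \<omega> j) + \<beta>)
              / (exp (\<theta> * (\<phi> \<omega> i + \<phi> \<omega> j) + \<beta>) + exp (- \<theta> * (\<phi> \<omega> i + \<phi> \<omega> j) - \<beta>)))
       \<and> (\<exists>c>0. distributed M (Pi\<^sub>M {1..n} (\<lambda>_. lborel)) \<phi>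
                  (\<lambda>x. ennreal (c * exp (- f_fun n \<theta> \<beta> x))))
       \<and> (\<forall>x y. p_fun \<theta> \<beta> x y = \<theta> / 4 * (x - y)\<^sup>2 + q_fun \<theta> \<beta> ((x + y) / 2))"
proof -
  interpret prob_space M by fact
  let ?B = "Pi\<^sub>M {1..n} (\<lambda>_. borel :: real measure)" and ?L = "Pi\<^sub>M {1..n} (\<lambda>_. lborel :: real measure)"
  define F where "F = gen_sigma M \<phi> ?B"
  \<comment> \<open>\<open>a x p\<close> is the external field on the spin of the edge
    \<open>p\<close>.\<close>
  define a where "a x = (\<lambda>(i, j). \<theta> * (x i + x j) + \<beta>)" for x :: "nat \<Rightarrow> real"
  define h where "h g x = two_star_prob n \<omega>1 \<omega>2 g *
    (\<Prod>i=1..n. normal_density (row_sum n (spin g) i / (real n - 1)) (1 / sqrt ((real n - 1) * \<theta>)) (x i))" for g x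
  define E where "E x = exp (- (\<Sum>(i, j)\<in>pairs n. \<theta> / 2 * ((x i)\<^sup>2 + (x j)\<^sup>2)))" for x :: "nat \<Rightarrow> real"
  obtain c where "c > 0" and h_eq: "\<And>g x. g \<in> graphs n \<Longrightarrow>
      h g x = c * E x * (\<Prod>(i, j)\<in>pairs n. exp (spin g i j * a x (i, j)))"
    using two_star_joint_density[OF assms(2-5)] unfolding h_def E_def a_def prod.case by blast
  have sum_h: "(\<Sum>g\<in>C. h g x) = c * E x * (\<Sum>g\<in>C. \<Prod>(i, j)\<in>pairs n. exp (spin g i j * a x (i, j)))"
    if "C \<subseteq> graphs n" for C x
    using that h_eq by (simp add: sum_distrib_left subset_eq)
  have sum_h_graphs: "(\<Sum>g\<in>graphs n. h g x) = c * 2 ^ card (pairs n) * exp (- f_fun n \<theta> \<beta> x)" for x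
  proof -
    \<comment> \<open>The Gaussian prefactor supplies the quadratic parts of \<open>p_fun\<close>,
      the sum over graphs its logarithms.\<close>
    have "E x * exp (\<Sum>p\<in>pairs n. ln (cosh (a x p))) = exp (- f_fun n \<theta> \<beta> x)"
      unfolding E_def f_fun_def p_fun_def a_def exp_add[symmetric]
      by (simp add: sum_subtractf split_def)
    then show ?thesis
      unfolding sum_h[OF subset_refl] sum_graphs_eq_cosh by (simp add: mult_ac)
  qed

  have sets_LB: "sets ?L = sets ?B" by (rule sets_PiM_cong) auto
  \<comment> \<open>The densities refer to \<open>lborel\<close>, the generated sigma-algebra to
    \<open>borel\<close>; only measurable sets count, and these agree.\<close>
  have F_eq: "F = gen_sigma M \<phi> ?L"
    unfolding F_def gen_sigma_def by (rule vimage_algebra_cong[OF refl refl sets_LB[symmetric]])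
  have G: "G \<in> measurable M (count_space (graphs n))"
    using assms(6) by (simp add: distributed_def)
  have Y_meas: "(\<lambda>\<omega>. Y \<omega> i j) \<in> borel_measurable M" for i j
    unfolding assms(7) by (rule measurable_compose[OF G]) simp
  have \<phi>: "\<phi> \<in> measurable M ?L"
    unfolding assms(11)
  proof (rule measurable_restrict)
    fix i assume "i \<in> {1..n}"
    then have [measurable]: "W i \<in> borel_measurable M"
      using assms(9) by (auto simp: distributed_def)
    note Y_meas[measurable]
    show "(\<lambda>\<omega>. row_sum n (Y \<omega>) i / (real n - 1) + W i \<omega> / sqrt ((real n - 1) * \<theta>)) \<in> measurable M lborel"
      unfolding row_sum_def by simp
  qed
  have h_meas: "h g \<in> borel_measurable ?L" for g
    unfolding h_def by measurable
  have h_nonneg: "0 \<le> h g x" for g x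
    unfolding h_def using two_star_prob_nonneg by (intro mult_nonneg_nonneg prod_nonneg) auto
  have joint: "emeasure M {\<omega> \<in> space M. G \<omega> = g \<and> \<phi> \<omega> \<in> A} = (\<integral>\<^sup>+x\<in>A. h g x \<partial>?L)"
    if "g \<in> graphs n" "A \<in> sets ?L" for g A
    unfolding h_def by (rule two_star_joint_law) (use assms that in simp_all)
  have pos: "0 < (\<Sum>g\<in>graphs n. h g x)" for x
    using \<open>c > 0\<close> by (simp add: sum_h_graphs)

  \<comment> \<open>Bayes' formula for cylinder events, in which \<open>c\<close> and
    \<open>E\<close> cancel. General \<open>J\<close> gives the joint conditional probabilities,
    singletons the marginal ones, so independence follows by comparison.\<close>
  have cprob: "AE \<omega> in M. cprob M F {\<omega> \<in> space M. \<forall>(i, j)\<in>J. Y \<omega> i j \<in> A (i, j)} \<omega>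
      = (\<Prod>p\<in>J. spin_prob (A p) (a (\<phi> \<omega>) p))" if J: "J \<subseteq> pairs n" for J A
  proof -
    let ?C = "{g \<in> graphs n. \<forall>(i, j)\<in>J. spin g i j \<in> A (i, j)}"
    have "{\<omega> \<in> space M. \<forall>(i, j)\<in>J. Y \<omega> i j \<in> A (i, j)} = {\<omega> \<in> space M. G \<omega> \<in> ?C}"
      using measurable_space[OF G] by (auto simp: assms(7))
    moreover have "(\<Sum>g\<in>?C. h g x) / (\<Sum>g\<in>graphs n. h g x) = (\<Prod>p\<in>J. spin_prob (A p) (a x p))" for x
      using \<open>c > 0\<close> spin_cylinder_ratio[OF J, where A = A and a = "a x"] by (simp add: sum_h E_def)
    ultimately show ?thesis
      unfolding F_eq
      using cprob_finite_mixture[OF finite_graphs G \<phi> h_meas h_nonneg pos joint, of ?C] by simp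
  qed
  have cprob1: "AE \<omega> in M. cprob M F {\<omega> \<in> space M. Y \<omega> i j \<in> A} \<omega> = spin_prob A (a (\<phi> \<omega>) (i, j))"
    if "(i, j) \<in> pairs n" for i j A
    using cprob[of "{(i, j)}" "\<lambda>_. A"] that by simp

  have "cond_indep_vars M F (\<lambda>_. borel) (\<lambda>(i, j) \<omega>. Y \<omega> i j) (pairs n)"
    unfolding cond_indep_vars_def
  proof (intro conjI ballI allI impI)
    have "\<phi> \<in> space M \<rightarrow> space ?L" using measurable_space[OF \<phi>] by auto
    then show "subalgebra M F"
      unfolding subalgebra_def F_eq gen_sigma_def using measurable_sets[OF \<phi>]
      by (auto simp: sets_vimage_algebra2)
    show "(case p of (i, j) \<Rightarrow> \<lambda>\<omega>. Y \<omega> i j) \<in> borel_measurable M" for p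
      using Y_meas by (cases p) simp
    fix J and A :: "nat \<times> nat \<Rightarrow> real set"
    assume J: "J \<subseteq> pairs n" "J \<noteq> {}" "finite J"
    let ?A = "\<lambda>p. (case p of (i, j) \<Rightarrow> \<lambda>\<omega>. Y \<omega> i j) -` A p \<inter> space M"
    \<comment> \<open>As \<open>J\<close> is finite, the exceptional null sets of its edges can be
      merged.\<close>
    have "AE \<omega> in M. \<forall>p\<in>J. cprob M F (?A p) \<omega> = spin_prob (A p) (a (\<phi> \<omega>) p)"
    proof (rule AE_finite_allI[OF J(3)])
      fix p assume "p \<in> J"
      moreover obtain i j where "p = (i, j)" by fastforce
      ultimately show "AE \<omega> in M. cprob M F (?A p) \<omega> = spin_prob (A p) (a (\<phi> \<omega>) p)"
        using cprob1[of i j "A p"] J(1) by (auto simp: vimage_def Int_def conj_commute)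
    qed
    \<comment> \<open>\<open>J \<noteq> {}\<close> keeps the intersection inside
      \<open>space M\<close>; an empty one would be \<open>UNIV\<close>.\<close>
    moreover have "(\<Inter>p\<in>J. ?A p) = {\<omega> \<in> space M. \<forall>(i, j)\<in>J. Y \<omega> i j \<in> A (i, j)}"
      using J(2) by auto
    ultimately show "AE \<omega> in M. cprob M F (\<Inter>p\<in>J. ?A p) \<omega> = (\<Prod>p\<in>J. cprob M F (?A p) \<omega>)"
      using cprob[OF J(1), of A] by (auto elim!: AE_mp)
  qed
  moreover have "AE \<omega> in M. cprob M F {\<omega> \<in> space M. Y \<omega> i j = 1} \<omega>
      = exp (\<theta> * (\<phi> \<omega> i + \<phi> \<omega> j) + \<beta>)
        / (exp (\<theta> * (\<phi> \<omega> i + \<phi> \<omega> j) + \<beta>) + exp (- \<theta> * (\<phi> \<omega> i + \<phi> \<omega> j) - \<beta>))"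
    if "(i, j) \<in> pairs n" for i j
    \<comment> \<open>As -1 is not in \<open>{1}\<close>, only the weight of the spin 1 survives in
      the numerator.\<close>
    using cprob1[OF that, of "{1}"] by (simp add: spin_prob_def a_def)
  moreover have "distributed M ?L \<phi> (\<lambda>x. ennreal (c * 2 ^ card (pairs n) * exp (- f_fun n \<theta> \<beta> x)))"
    using finite_mixture_distributed(2)[OF finite_graphs G \<phi> h_meas h_nonneg joint]
    unfolding sum_h_graphs .
  ultimately show ?thesis
    using \<open>c > 0\<close> p_fun_eq_q_fun unfolding F_def
    by (intro conjI exI[of _ "c * 2 ^ card (pairs n)"]) auto
qed

end
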